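(* Let $d\in\mathbb N$, let $B_d\subseteq\mathbb R^d$ be the Euclidean unit ball with normalized Lebesgue measure $\mu$ (so $\mu(B_d)=1$), and let $\sigma(x)=\max\{0,x\}$. For all $a\in\mathbb R^d$ and $b\in\mathbb R$, $$\int_{B_d}\sigma(a\cdot x-b)\,d\mu(x)=\begin{cases}-b&\text{if }b\le-|a|,\\[2pt]\dfrac{|a|}{(d+1)\beta(\frac12,\frac{d+1}2)}\Big(1-\big(\tfrac b{|a|}\big)^2\Big)^{\frac{d+1}2}-\dfrac b2\Big(1+I_{(b/|a|)^2}\big(\tfrac12,\tfrac{d+1}2\big)\Big)&\text{if }-|a|<b<0,\\[6pt]\dfrac{|a|}{(d+1)\beta(\frac12,\frac{d+1}2)}\Big(1-\big(\tfrac b{|a|}\big)^2\Big)^{\frac{d+1}2}-\dfrac b2\Big(1-I_{(b/|a|)^2}\big(\tfrac12,\tfrac{d+1}2\big)\Big)&\text{if }0\le b<|a|,\\[2pt]0&\text{if }|a|\le b.\end{cases}$$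
   Context: $|a|$ is the Euclidean norm. $\beta(p,q)=\int_0^1v^{p-1}(1-v)^{q-1}\,dv$ is the beta function, $\beta_x(p,q)=\int_0^xv^{p-1}(1-v)^{q-1}\,dv$ the incomplete beta function, and $I_x(p,q)=\beta_x(p,q)/\beta(p,q)$ the regularized incomplete beta function. *)

theory Defs
  imports "HOL-Analysis.Analysis"
begin

definition relu :: "real \<Rightarrow> real" where
  "relu x = max 0 x"

definition incomplete_beta :: "real \<Rightarrow> real \<Rightarrow> real \<Rightarrow> real" where
  "incomplete_beta x p q = integral {0..x} (\<lambda>v. v powr (p - 1) * (1 - v) powr (q - 1))"

text \<open>
  The library defines \<^const>\<open>Beta\<close> through \<^const>\<open>Gamma\<close>; for positive parameters it is the
  complete integral.
\<close>

lemma incomplete_beta_1: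
  fixes p q :: real
  assumes "p > 0" "q > 0"
  shows "incomplete_beta 1 p q = Beta p q"
  unfolding incomplete_beta_def
  by (rule integral_unique[OF has_integral_Beta_real[OF assms]])

definition regularized_incomplete_beta :: "real \<Rightarrow> real \<Rightarrow> real \<Rightarrow> real" where
  "regularized_incomplete_beta x p q = incomplete_beta x p q / Beta p q"

definition unit_ball_measure :: "(real ^ 'n) measure" where
  "unit_ball_measure = uniform_measure lebesgue (cball 0 1)"

end

theory Submission
  imports Defs
begin

text \<open>
  By rotation invariance \<open>a\<close> may be taken along a coordinate axis. Slicing the ball orthogonally
  to that axis gives the coordinate along it the density \<open>(1 - t\<^sup>2) powr ((d - 1) / 2)\<close> on
  \<open>[-1, 1]\<close>, up to normalisation by a Beta function. The linear part of the remaining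
  one-dimensional integral has an elementary antiderivative, and the substitution \<open>v = t\<^sup>2\<close> turns
  the constant part into an incomplete Beta function. The density is written as
  \<open>sqrt (1 - t\<^sup>2) ^ (d - 1)\<close>: for \<open>d = 1\<close>, \<open>powr\<close> would be discontinuous at \<open>t = \<plusminus>1\<close>,
  since \<open>0 powr 0 = 0\<close>.
\<close>

section \<open>Slicing the ball along a coordinate axis\<close>

text \<open>Tonelli, with the coordinate along \<open>e\<close> integrated last: the slice of the
  ball at height \<open>t\<close> is a ball of radius \<open>sqrt (1 - t^2)\<close> in one dimension
  less, and its volume is the density. Values in \<open>ennreal\<close> avoid integrability
  conditions.\<close>

lemma nn_integral_cball_Basis:
  fixes e :: "'a::euclidean_space" and g :: "real \<Rightarrow> ennreal"
  assumes e: "e \<in> Basis" and [measurable]: "g \<in> borel_measurable borel"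
  shows "(\<integral>\<^sup>+x. g (x \<bullet> e) * indicator (cball 0 1) x \<partial>lborel) =
    (\<integral>\<^sup>+t. g t * ennreal (unit_ball_vol (DIM('a) - 1) * sqrt (1 - t\<^sup>2) ^ (DIM('a) - 1))
       * indicator {-1..1} t \<partial>lborel)"
proof -
  interpret product_sigma_finite "\<lambda>_. lborel"
    by standard
  have [measurable]: "cball 0 1 \<in> sets (borel :: 'a measure)" by simp
  define B where "B = Basis - {e}"
  have B: "finite B" "e \<notin> B" "insert e B = Basis" "card B = DIM('a) - 1"
    using e by (auto simp: B_def)
  \<comment> \<open>The closed ball of radius \<open>r\<close> in the coordinates other than
    \<open>e\<close>, in the shape whose volume \<open>emeasure_cball_aux\<close> computes.\<close>
  define S :: "real \<Rightarrow> ('a \<Rightarrow> real) set" where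
    "S r = {f. sqrt (\<Sum>i\<in>B. (f i)\<^sup>2) \<le> r} \<inter> space (Pi\<^sub>M B (\<lambda>_. lborel))" for r
  have [measurable]: "S r \<in> sets (Pi\<^sub>M B (\<lambda>_. lborel))" for r
    unfolding S_def by measurable
  have eval: "(\<lambda>f. f i) \<in> borel_measurable (Pi\<^sub>M Basis (\<lambda>_. lborel :: real measure))" if "i \<in> Basis" for i :: 'a
    using measurable_component_singleton[OF that, of "\<lambda>_. lborel"] by simp
  have sq: "(\<lambda>f. \<Sum>i\<in>Basis. (f i)\<^sup>2) \<in> borel_measurable (Pi\<^sub>M (Basis :: 'a set) (\<lambda>_. lborel :: real measure))"
    by (intro borel_measurable_sum borel_measurable_power eval)
  have integrand: "(\<lambda>f. g (f e) * indicator {..1} (\<Sum>i\<in>Basis. (f i)\<^sup>2))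
      \<in> borel_measurable (Pi\<^sub>M Basis (\<lambda>_. lborel))"
    by (intro borel_measurable_times_ennreal measurable_compose[OF sq]
        measurable_compose[OF eval[OF e]]) auto
  have emb: "(\<lambda>f. \<Sum>b\<in>Basis. f b *\<^sub>R b :: 'a)
      \<in> measurable (Pi\<^sub>M Basis (\<lambda>_. lborel)) borel"
    by (intro borel_measurable_sum borel_measurable_scaleR borel_measurable_const eval)
  have cball_iff: "indicator (cball 0 1) (\<Sum>b\<in>Basis. f b *\<^sub>R b :: 'a) =
      (indicator {..1} (\<Sum>i\<in>Basis. (f i)\<^sup>2) :: ennreal)" for f
  proof -
    define x :: 'a where "x = (\<Sum>b\<in>Basis. f b *\<^sub>R b)"
    have "(norm x)\<^sup>2 = (\<Sum>i\<in>Basis. (x \<bullet> i)\<^sup>2)"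
      unfolding power2_norm_eq_inner by (subst euclidean_inner) (simp add: power2_eq_square)
    also have "\<dots> = (\<Sum>i\<in>Basis. (f i)\<^sup>2)"
      by (intro sum.cong) (auto simp: x_def)
    finally show ?thesis
      using abs_square_le_1[of "norm x"] by (auto simp: indicator_def x_def[symmetric])
  qed
  have sections: "g y * indicator {..1} (\<Sum>i\<in>Basis. ((x(e := y)) i)\<^sup>2) =
      g y * indicator {-1..1} y * indicator (S (sqrt (1 - y\<^sup>2))) x"
    if "x \<in> space (Pi\<^sub>M B (\<lambda>_. lborel))" for x y
  proof -
    have "(\<Sum>i\<in>Basis. ((x(e := y)) i)\<^sup>2) = y\<^sup>2 + (\<Sum>i\<in>B. ((x(e := y)) i)\<^sup>2)"
      using B(1,2) by (subst B(3)[symmetric], subst sum.insert) auto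
    also have "(\<Sum>i\<in>B. ((x(e := y)) i)\<^sup>2) = (\<Sum>i\<in>B. (x i)\<^sup>2)"
      using B(2) by (intro sum.cong) auto
    finally have eq: "(\<Sum>i\<in>Basis. ((x(e := y)) i)\<^sup>2) = y\<^sup>2 + (\<Sum>i\<in>B. (x i)\<^sup>2)" .
    have nn: "0 \<le> (\<Sum>i\<in>B. (x i)\<^sup>2)" by (simp add: sum_nonneg)
    have "y\<^sup>2 + (\<Sum>i\<in>B. (x i)\<^sup>2) \<le> 1 \<longleftrightarrow>
        y \<in> {-1..1} \<and> sqrt (\<Sum>i\<in>B. (x i)\<^sup>2) \<le> sqrt (1 - y\<^sup>2)"
      using nn abs_square_le_1[of y] by (auto simp: abs_le_iff)
    then show ?thesis using that eq by (auto simp: S_def indicator_def)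
  qed
  \<comment> \<open>The endpoints -1 and 1 are left out so that the radius is positive; they form a
    null set and are discarded in the last step.\<close>
  have slice: "emeasure (Pi\<^sub>M B (\<lambda>_. lborel)) (S (sqrt (1 - y\<^sup>2))) =
      ennreal (unit_ball_vol (DIM('a) - 1) * sqrt (1 - y\<^sup>2) ^ (DIM('a) - 1))"
    if "-1 < y" "y < 1" for y
  proof -
    have "y\<^sup>2 < 1" using that by (simp add: abs_square_less_1 abs_less_iff)
    then show ?thesis unfolding S_def using emeasure_cball_aux[OF B(1), of "sqrt (1 - y\<^sup>2)"]
      by (simp add: B(4))
  qed
  have "(\<integral>\<^sup>+x. g (x \<bullet> e) * indicator (cball 0 1) x \<partial>lborel) =
      (\<integral>\<^sup>+f. g ((\<Sum>b\<in>Basis. f b *\<^sub>R b) \<bullet> e) * indicator (cball 0 1) (\<Sum>b\<in>Basis. f b *\<^sub>R b :: 'a)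
        \<partial>Pi\<^sub>M Basis (\<lambda>_. lborel))"
    by (subst lborel_eq, rule nn_integral_distr[OF emb]) measurable
  also have "\<dots> = (\<integral>\<^sup>+f. g (f e) * indicator {..1} (\<Sum>i\<in>Basis. (f i)\<^sup>2)
        \<partial>Pi\<^sub>M Basis (\<lambda>_. lborel))"
    using e by (intro nn_integral_cong) (simp add: cball_iff)
  also have "\<dots> = (\<integral>\<^sup>+f. g (f e) * indicator {..1} (\<Sum>i\<in>Basis. (f i)\<^sup>2)
        \<partial>Pi\<^sub>M (insert e B) (\<lambda>_. lborel))"
    by (simp only: B(3))
  also have "\<dots> = (\<integral>\<^sup>+y. \<integral>\<^sup>+x. g ((x(e := y)) e) *
        indicator {..1} (\<Sum>i\<in>Basis. ((x(e := y)) i)\<^sup>2) \<partial>Pi\<^sub>M B (\<lambda>_. lborel) \<partial>lborel)"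
    by (rule product_nn_integral_insert_rev) (use B integrand in auto)
  also have "\<dots> = (\<integral>\<^sup>+y. \<integral>\<^sup>+x. g y * indicator {-1..1} y *
        indicator (S (sqrt (1 - y\<^sup>2))) x \<partial>Pi\<^sub>M B (\<lambda>_. lborel) \<partial>lborel)"
    by (intro nn_integral_cong) (simp only: fun_upd_same sections)
  also have "\<dots> = (\<integral>\<^sup>+y. g y * indicator {-1..1} y *
        emeasure (Pi\<^sub>M B (\<lambda>_. lborel)) (S (sqrt (1 - y\<^sup>2))) \<partial>lborel)"
    by (simp add: nn_integral_cmult)
  also have "\<dots> = (\<integral>\<^sup>+t. g t * ennreal (unit_ball_vol (DIM('a) - 1) *
        sqrt (1 - t\<^sup>2) ^ (DIM('a) - 1)) * indicator {-1..1} t \<partial>lborel)"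
  proof (intro nn_integral_cong_AE)
    have "AE y in lborel. y \<notin> {-1, 1::real}"
      by (intro AE_not_in countable_imp_null_set_lborel) auto
    then show "AE y in lborel. g y * indicator {-1..1} y *
        emeasure (Pi\<^sub>M B (\<lambda>_. lborel)) (S (sqrt (1 - y\<^sup>2))) =
        g y * ennreal (unit_ball_vol (DIM('a) - 1) * sqrt (1 - y\<^sup>2) ^ (DIM('a) - 1))
          * indicator {-1..1} y"
      by eventually_elim (auto simp: indicator_def slice)
  qed
  finally show ?thesis .
qed

section \<open>Invariance of Lebesgue measure under orthogonal maps\<close>

text \<open>
  The library's \<^term>\<open>measure_orthogonal_image\<close> needs a well-ordered index type. Here invariance
  comes instead from the Vitali covering theorem: an open set is a disjoint union of balls up to
  a null set, and isometries preserve balls and null sets.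
\<close>

lemma emeasure_orthogonal_vimage_open:
  fixes f :: "'a::euclidean_space \<Rightarrow> 'a"
  assumes f: "orthogonal_transformation f" and S: "open S"
  shows "emeasure lborel (f -` S) = emeasure lborel S"
proof -
  have bij: "bij f" using f by (rule orthogonal_transformation_bij)
  have inv: "orthogonal_transformation (inv f)" using f by (rule orthogonal_transformation_inv)
  have vimage_ball: "f -` ball c r = ball (inv f c) r" for c r
  proof -
    have "dist c (f x) = dist (inv f c) x" for x
      using f bij unfolding orthogonal_transformation_isometry
      by (metis bij_is_surj surj_f_inv_f)
    then show ?thesis by auto
  qed
  define K where "K = {(c, r). 0 < r \<and> ball c r \<subseteq> S}"
  obtain C where C: "countable C" "C \<subseteq> K"
    "pairwise (\<lambda>i j. disjnt (ball (fst i) (snd i)) (ball (fst j) (snd j))) C"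
    "negligible (S - (\<Union>i\<in>C. ball (fst i) (snd i)))"
  proof (rule Vitali_covering_theorem_balls[of S K fst snd])
    fix x and d :: real
    assume "x \<in> S" "0 < d"
    with S obtain e where e: "0 < e" "ball x e \<subseteq> S" by (meson openE)
    \<comment> \<open>This radius keeps the ball inside \<open>S\<close> and lies strictly below the
      prescribed bound \<open>d\<close>.\<close>
    then have "(x, min e (d / 2)) \<in> K"
      using \<open>0 < d\<close> by (auto simp: K_def)
    moreover have "x \<in> ball x (min e (d / 2))" "min e (d / 2) < d"
      using e \<open>0 < d\<close> by auto
    ultimately show "\<exists>i. i \<in> K \<and> x \<in> ball (fst i) (snd i) \<and> snd i < d"
      by (metis fst_conv snd_conv)
  qed (rule that)
  define U where "U = (\<Union>i\<in>C. ball (fst i) (snd i))"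
  have K: "0 < snd i" "ball (fst i) (snd i) \<subseteq> S" if "i \<in> C" for i
    using subsetD[OF C(2) that] by (simp_all add: K_def case_prod_beta)
  then have U: "open U" "U \<subseteq> S"
    unfolding U_def by blast+
  have vimage_U: "f -` U = (\<Union>i\<in>C. ball (inv f (fst i)) (snd i))"
    unfolding U_def vimage_UN vimage_ball ..
  have disj: "disjoint_family_on (\<lambda>i. ball (fst i) (snd i)) C"
    using C(3) by (auto simp: disjoint_family_on_def pairwise_def disjnt_def)
  then have disj': "disjoint_family_on (\<lambda>i. ball (inv f (fst i)) (snd i)) C"
    unfolding vimage_ball[symmetric] disjoint_family_on_def by blast
  \<comment> \<open>Moving the centres changes neither the radii nor the disjointness, so both
    unions have the same total volume.\<close>
  have "emeasure lborel (f -` U) =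
      (\<integral>\<^sup>+i. emeasure lborel (ball (inv f (fst i)) (snd i)) \<partial>count_space C)"
    unfolding vimage_U using C(1) disj' by (intro emeasure_UN_countable) auto
  also have "\<dots> = (\<integral>\<^sup>+i. emeasure lborel (ball (fst i) (snd i)) \<partial>count_space C)"
    using K(1) by (intro nn_integral_cong) (simp add: emeasure_ball less_imp_le)
  also have "\<dots> = emeasure lborel U"
    unfolding U_def using C(1) disj by (intro emeasure_UN_countable[symmetric]) auto
  finally have eqU: "emeasure lborel (f -` U) = emeasure lborel U" .
  have cont: "continuous_on UNIV f"
    using f by (intro linear_continuous_on)
      (simp add: orthogonal_transformation_linear linear_linear)
  have open_vimage: "open (f -` T)" if "open T" for T
    using cont that by (simp add: open_vimage)
  \<comment> \<open>A difference of open sets is Borel, so negligibility, a statement about the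
    completed measure, gives a null set of \<open>lborel\<close>.\<close>
  have add_null: "emeasure lborel B = emeasure lborel A"
    if "open A" "open B" "A \<subseteq> B" "negligible (B - A)" for A B :: "'a set"
  proof -
    have "B - A \<in> null_sets lborel"
      using that by (auto simp: negligible_iff_null_sets null_sets_completion_iff)
    then have "emeasure lborel (A \<union> (B - A)) = emeasure lborel A"
      using that by (intro emeasure_Un_null_set) auto
    then show ?thesis using that by (simp add: Un_absorb1)
  qed
  \<comment> \<open>A linear image of a null set is null, so the part of \<open>S\<close> missed by
    the balls stays null after pulling back.\<close>
  have "negligible (inv f ` (S - U))"
    using C(4) inv by (intro negligible_differentiable_image_negligible)
      (auto simp: U_def orthogonal_transformation_linear linear_imp_differentiable_on)
  then have "negligible (f -` S - f -` U)"
    using bij by (simp add: bij_vimage_eq_inv_image[symmetric] vimage_Diff)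
  then have "emeasure lborel (f -` S) = emeasure lborel (f -` U)"
    using U S by (intro add_null open_vimage) auto
  also have "\<dots> = emeasure lborel S"
    unfolding eqU using U S C(4) by (intro add_null[symmetric]) (auto simp: U_def)
  finally show ?thesis .
qed

text \<open>\<open>lborel\<close> is determined by its values on boxes, and boxes are open.\<close>

lemma lborel_distr_orthogonal_transformation:
  fixes f :: "'a::euclidean_space \<Rightarrow> 'a"
  assumes f: "orthogonal_transformation f"
  shows "distr lborel borel f = lborel"
proof (rule lborel_eqI[symmetric])
  fix l u :: 'a
  assume le: "\<And>b. b \<in> Basis \<Longrightarrow> l \<bullet> b \<le> u \<bullet> b"
  have [measurable]: "f \<in> borel_measurable borel"
    using f by (intro borel_measurable_continuous_onI linear_continuous_on)
      (simp add: orthogonal_transformation_linear linear_linear)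
  have "emeasure (distr lborel borel f) (box l u) = emeasure lborel (f -` box l u)"
    by (simp add: emeasure_distr)
  also have "\<dots> = emeasure lborel (box l u)"
    using f by (intro emeasure_orthogonal_vimage_open) auto
  also have "\<dots> = ennreal (\<Prod>b\<in>Basis. (u - l) \<bullet> b)"
    using le by simp
  finally show "emeasure (distr lborel borel f) (box l u) = ennreal (\<Prod>b\<in>Basis. (u - l) \<bullet> b)" .
qed simp

text \<open>An orthogonal \<open>f\<close> carries a multiple of the basis vector \<open>e\<close>
  to \<open>a\<close>. Substituting \<open>f x\<close> for \<open>x\<close> preserves the ball and
  turns the inner product with \<open>a\<close> into \<open>norm a\<close> times a coordinate, to
  which the slicing formula applies.\<close>

lemma nn_integral_cball_inner:
  fixes a :: "real ^ 'n" and g :: "real \<Rightarrow> ennreal"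
  assumes [measurable]: "g \<in> borel_measurable borel"
  shows "(\<integral>\<^sup>+x. g (a \<bullet> x) * indicator (cball 0 1) x \<partial>lborel) =
    (\<integral>\<^sup>+t. g (norm a * t) * ennreal (unit_ball_vol (CARD('n) - 1) * sqrt (1 - t\<^sup>2) ^ (CARD('n) - 1))
       * indicator {-1..1} t \<partial>lborel)"
proof -
  have [measurable]: "cball 0 1 \<in> sets (borel :: (real ^ 'n) measure)" by simp
  fix k :: 'n
  define e :: "real ^ 'n" where "e = axis k 1"
  have e: "e \<in> Basis" by (simp add: e_def)
  then have "norm (norm a *\<^sub>R e) = norm a" by simp
  then obtain f where f: "orthogonal_transformation f" "f (norm a *\<^sub>R e) = a"
    using orthogonal_transformation_exists by blast
  have [measurable]: "f \<in> borel_measurable borel"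
    using f(1) by (intro borel_measurable_continuous_onI linear_continuous_on)
      (simp add: orthogonal_transformation_linear linear_linear)
  have inner: "a \<bullet> f x = norm a * (x \<bullet> e)" for x
  proof -
    have "f (norm a *\<^sub>R e) \<bullet> f x = (norm a *\<^sub>R e) \<bullet> x"
      using f(1) unfolding orthogonal_transformation_def by blast
    then show ?thesis unfolding f(2) by (simp add: inner_commute)
  qed
  have norm: "norm (f x) = norm x" for x
    using f(1) by (rule orthogonal_transformation_norm)
  have "(\<integral>\<^sup>+x. g (a \<bullet> x) * indicator (cball 0 1) x \<partial>lborel) =
      (\<integral>\<^sup>+x. g (a \<bullet> f x) * indicator (cball 0 1) (f x) \<partial>lborel)"
    by (subst lborel_distr_orthogonal_transformation[OF f(1), symmetric],
        subst nn_integral_distr) measurable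
  also have "\<dots> = (\<integral>\<^sup>+x. g (norm a * (x \<bullet> e)) * indicator (cball 0 1) x \<partial>lborel)"
    by (simp add: inner norm indicator_def)
  also have "\<dots> = (\<integral>\<^sup>+t. g (norm a * t) *
      ennreal (unit_ball_vol (CARD('n) - 1) * sqrt (1 - t\<^sup>2) ^ (CARD('n) - 1))
       * indicator {-1..1} t \<partial>lborel)"
    using nn_integral_cball_Basis[OF e, of "\<lambda>t. g (norm a * t)"] by simp
  finally show ?thesis .
qed

section \<open>Integrals of the density over subintervals\<close>

lemma powr_half_of_nat: "0 < x \<Longrightarrow> x powr (real n / 2) = sqrt x ^ n"
  by (simp add: powr_half_sqrt_powr powr_realpow real_sqrt_power)

lemma continuous_on_sqrt_power: "continuous_on S (\<lambda>t. sqrt (1 - t\<^sup>2) ^ n)"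
  by (intro continuous_intros)

lemma integral_sqrt_power_reflect:
  "integral {-c..0} (\<lambda>t. sqrt (1 - t\<^sup>2) ^ n) = integral {0..c::real} (\<lambda>t. sqrt (1 - t\<^sup>2) ^ n)"
  using Henstock_Kurzweil_Integration.integral_reflect_real[of c 0 "\<lambda>t. sqrt (1 - t\<^sup>2) ^ n"]
  by simp

text \<open>The substitution \<open>v = t^2\<close> in antiderivative form: by the chain rule,
  \<open>2 * G (sqrt v)\<close> differentiates to the Beta integrand.\<close>

lemma incomplete_beta_power2:
  assumes c: "0 \<le> c" "c \<le> 1"
  shows "incomplete_beta (c\<^sup>2) (1/2) (real n / 2 + 1) = 2 * integral {0..c} (\<lambda>t. sqrt (1 - t\<^sup>2) ^ n)"
proof -
  define w where "w = (\<lambda>t::real. sqrt (1 - t\<^sup>2) ^ n)"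
  define G where "G x = integral {0..x} w" for x
  have cont: "continuous_on S w" for S
    unfolding w_def by (rule continuous_on_sqrt_power)
  have G: "(G has_real_derivative w x) (at x)" if "0 < x" "x < c" for x
  proof -
    have "(G has_real_derivative w x) (at x within {0..c})"
      unfolding G_def[abs_def] using that by (intro integral_has_real_derivative cont) auto
    then show ?thesis
      using at_within_Icc_at[OF that] by simp
  qed
  have contG: "continuous_on {0..c} G"
    unfolding G_def using cont
    by (intro indefinite_integral_continuous_1 integrable_continuous_interval)
  have "((\<lambda>v. v powr (1/2 - 1) * (1 - v) powr (real n / 2 + 1 - 1)) has_integral
      2 * G (sqrt (c\<^sup>2)) - 2 * G (sqrt 0)) {0..c\<^sup>2}"
  \<comment> \<open>Derivatives are needed only in the interior, with continuity up to the
    endpoints; \<open>sqrt\<close> has no derivative at 0.\<close>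
  proof (rule fundamental_theorem_of_calculus_interior)
    show "continuous_on {0..c\<^sup>2} (\<lambda>v. 2 * G (sqrt v))"
      using c by (intro continuous_intros continuous_on_compose2[OF contG])
        (auto simp: real_le_lsqrt)
  next
    fix v assume v: "v \<in> {0<..<c\<^sup>2}"
    then have sv: "0 < sqrt v" "sqrt v < c"
      using c by (auto simp: real_less_lsqrt)
    have "c\<^sup>2 \<le> 1" using c by (simp add: power_le_one)
    with v have "v < 1" by simp
    have "((\<lambda>v. 2 * G (sqrt v)) has_real_derivative 2 * (w (sqrt v) * (inverse (sqrt v) / 2))) (at v)"
      using v by (auto intro!: derivative_eq_intros DERIV_chain2[OF G] sv)
    moreover have "2 * (w (sqrt v) * (inverse (sqrt v) / 2)) =
        v powr (1/2 - 1) * (1 - v) powr (real n / 2 + 1 - 1)"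
      using v \<open>v < 1\<close> by (simp add: w_def powr_half_of_nat powr_minus powr_half_sqrt)
    ultimately show "((\<lambda>v. 2 * G (sqrt v)) has_vector_derivative
        v powr (1/2 - 1) * (1 - v) powr (real n / 2 + 1 - 1)) (at v)"
      by (simp add: has_real_derivative_iff_has_vector_derivative)
  qed simp
  then show ?thesis
    using c unfolding incomplete_beta_def by (simp add: integral_unique G_def w_def)
qed

text \<open>The density is even, so \<open>{0..1}\<close> carries half of the Beta value. The
  stretch between 0 and \<open>c\<close> is removed for positive \<open>c\<close> and added for
  negative \<open>c\<close>, hence the factor \<open>sgn c\<close>.\<close>

lemma integral_sqrt_power_tail:
  assumes c: "-1 \<le> c" "c \<le> 1"
  shows "integral {c..1} (\<lambda>t. sqrt (1 - t\<^sup>2) ^ n) =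
    (Beta (1/2) (real n / 2 + 1) - sgn c * incomplete_beta (c\<^sup>2) (1/2) (real n / 2 + 1)) / 2"
proof -
  define w where "w = (\<lambda>t::real. sqrt (1 - t\<^sup>2) ^ n)"
  have int: "w integrable_on {x..y}" for x y
    unfolding w_def by (intro integrable_continuous_interval continuous_on_sqrt_power)
  have total: "Beta (1/2) (real n / 2 + 1) = 2 * integral {0..1} w"
    using incomplete_beta_power2[of 1 n] incomplete_beta_1[of "1/2" "real n / 2 + 1"]
    by (simp add: w_def)
  show ?thesis
  proof (cases "0 \<le> c")
    case True
    have "integral {0..c} w + integral {c..1} w = integral {0..1} w"
      using True c int by (intro Henstock_Kurzweil_Integration.integral_combine) auto
    \<comment> \<open>At \<open>c = 0\<close> the sign vanishes, and so does the integral over a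
      single point.\<close>
    moreover have "sgn c * incomplete_beta (c\<^sup>2) (1/2) (real n / 2 + 1) = 2 * integral {0..c} w"
      using incomplete_beta_power2[of c n] True c by (cases "c = 0") (auto simp: w_def)
    ultimately show ?thesis
      unfolding total by (simp add: w_def)
  next
    case False
    have "integral {c..0} w + integral {0..1} w = integral {c..1} w"
      using False c int by (intro Henstock_Kurzweil_Integration.integral_combine) auto
    moreover have "incomplete_beta (c\<^sup>2) (1/2) (real n / 2 + 1) = 2 * integral {c..0} w"
      using incomplete_beta_power2[of "-c" n] integral_sqrt_power_reflect[of "-c" n] False c
      by (simp add: w_def)
    ultimately show ?thesis
      unfolding total using False by (simp add: w_def)
  qed
qed

text \<open>The linear part has the antiderivative
  \<open>- sqrt (1 - t^2) ^ (n + 2) / (n + 2)\<close>, which vanishes at 1. The constant part stays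
  an integral, to be evaluated by \<open>integral_sqrt_power_tail\<close>.\<close>

lemma has_integral_affine_sqrt_power:
  assumes c: "-1 \<le> c" "c \<le> 1"
  shows "((\<lambda>t. (A * t - b) * sqrt (1 - t\<^sup>2) ^ n) has_integral
    A / (real n + 2) * sqrt (1 - c\<^sup>2) ^ (n + 2) - b * integral {c..1} (\<lambda>t. sqrt (1 - t\<^sup>2) ^ n)) {c..1}"
proof -
  have "((\<lambda>t. t * sqrt (1 - t\<^sup>2) ^ n) has_integral
      - (1 / (real n + 2)) * sqrt (1 - 1\<^sup>2) ^ (n + 2)
      - - (1 / (real n + 2)) * sqrt (1 - c\<^sup>2) ^ (n + 2)) {c..1}"
  proof (rule fundamental_theorem_of_calculus_interior)
    fix t :: real assume "t \<in> {c<..<1}"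
    then have "0 < 1 - t\<^sup>2" using c by (simp add: abs_square_less_1 abs_less_iff)
    have "((\<lambda>t. 1 - t\<^sup>2) has_real_derivative - (2 * t)) (at t)"
      by (auto intro!: derivative_eq_intros)
    with DERIV_real_sqrt[OF \<open>0 < 1 - t\<^sup>2\<close>]
    have sqrt: "((\<lambda>t. sqrt (1 - t\<^sup>2)) has_real_derivative
        inverse (sqrt (1 - t\<^sup>2)) / 2 * - (2 * t)) (at t)"
      by (rule DERIV_chain2)
    \<comment> \<open>With \<open>s = sqrt (1 - t^2)\<close>, the factor \<open>inverse s\<close>
      cancels one factor of \<open>s * p = s ^ (n + 1)\<close>; \<open>m = n + 2\<close> comes from
      the power rule.\<close>
    have "- (1 / m) * (m * (inverse s / 2 * - (2 * t) * (s * p))) = t * p"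
      if "m \<noteq> 0" "s \<noteq> 0" for m s p :: real
      using that by simp
    from this[of "real n + 2" "sqrt (1 - t\<^sup>2)" "sqrt (1 - t\<^sup>2) ^ n"]
    have "- (1 / (real n + 2)) * ((real n + 2) * (inverse (sqrt (1 - t\<^sup>2)) / 2 * - (2 * t) *
        sqrt (1 - t\<^sup>2) ^ Suc n)) = t * sqrt (1 - t\<^sup>2) ^ n"
      using \<open>0 < 1 - t\<^sup>2\<close> unfolding power_Suc by fastforce
    moreover have "real (n + 2) = real n + 2" "n + 2 - Suc 0 = Suc n" by auto
    ultimately have "((\<lambda>t. - (1 / (real n + 2)) * sqrt (1 - t\<^sup>2) ^ (n + 2)) has_real_derivative
        t * sqrt (1 - t\<^sup>2) ^ n) (at t)"
      using DERIV_cmult[OF DERIV_power[OF sqrt, of "n + 2"], of "- (1 / (real n + 2))"]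
      by metis
    then show "((\<lambda>t. - (1 / (real n + 2)) * sqrt (1 - t\<^sup>2) ^ (n + 2)) has_vector_derivative
        t * sqrt (1 - t\<^sup>2) ^ n) (at t)"
      by (simp add: has_real_derivative_iff_has_vector_derivative)
  qed (use c in \<open>auto intro!: continuous_intros\<close>)
  from has_integral_mult_right[OF this, of A]
  have lin: "((\<lambda>t. A * (t * sqrt (1 - t\<^sup>2) ^ n)) has_integral
      A / (real n + 2) * sqrt (1 - c\<^sup>2) ^ (n + 2)) {c..1}" by simp
  have const: "((\<lambda>t. b * sqrt (1 - t\<^sup>2) ^ n) has_integral
      b * integral {c..1} (\<lambda>t. sqrt (1 - t\<^sup>2) ^ n)) {c..1}"
    by (intro has_integral_mult_right integrable_integral integrable_continuous_interval
        continuous_on_sqrt_power)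
  show ?thesis
    using has_integral_diff[OF lin const] by (simp only: left_diff_distrib mult.assoc)
qed

section \<open>Normalisation by the volume of the ball\<close>

text \<open>Written through \<open>Gamma\<close>, the factor \<open>Gamma (n / 2 + 1)\<close>
  cancels, and \<open>Gamma (1/2) = sqrt pi\<close> supplies the missing half power of
  \<open>pi\<close>.\<close>

lemma unit_ball_vol_Suc:
  "unit_ball_vol (real (Suc n)) = unit_ball_vol (real n) * Beta (1/2) (real n / 2 + 1)"
  by (auto simp: unit_ball_vol_def Beta_def Gamma_eq_zero_iff field_simps
        Gamma_one_half_real powr_half_sqrt [symmetric] powr_add [symmetric])

text \<open>The slice integral carries the factor \<open>unit_ball_vol n\<close>, which the volume
  of the whole ball contains as well; the quotient leaves only the Beta value. Each case of the
  theorem then just has to supply \<open>I\<close>.\<close>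

lemma integral_relu_unit_ball_measure:
  fixes a :: "real ^ 'n"
  assumes n: "CARD('n) = Suc n"
    and I: "((\<lambda>t. relu (norm a * t - b) * sqrt (1 - t\<^sup>2) ^ n) has_integral I) {-1..1}"
  shows "(LINT x:cball 0 1|unit_ball_measure. relu (a \<bullet> x - b)) = I / Beta (1/2) (real n / 2 + 1)"
proof -
  have [measurable]: "relu \<in> borel_measurable borel"
    unfolding relu_def[abs_def] by measurable
  have relu_nonneg: "0 \<le> relu x" for x by (simp add: relu_def)
  have sqrt_nonneg: "0 \<le> sqrt (1 - t\<^sup>2) ^ n" if "t \<in> {-1..1}" for t
    using that by (simp add: abs_square_le_1 abs_le_iff)
  have Beta_pos: "0 < Beta (1/2) (real n / 2 + 1)"
    by (simp add: Beta_def Gamma_real_pos)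
  have vol_pos: "0 < unit_ball_vol n" by simp
  have I_nonneg: "0 \<le> I"
    using I by (rule has_integral_nonneg) (simp add: relu_nonneg sqrt_nonneg)
  have "(\<integral>\<^sup>+x. ennreal (relu (a \<bullet> x - b)) * indicator (cball 0 1) x \<partial>lborel) =
      (\<integral>\<^sup>+t. ennreal (relu (norm a * t - b)) * ennreal (unit_ball_vol n * sqrt (1 - t\<^sup>2) ^ n)
        * indicator {-1..1} t \<partial>lborel)"
    using nn_integral_cball_inner[of "\<lambda>t. ennreal (relu (t - b))" a] n by simp
  also have "\<dots> = (\<integral>\<^sup>+t. ennreal (unit_ball_vol n * (relu (norm a * t - b) * sqrt (1 - t\<^sup>2) ^ n))
        * indicator {-1..1} t \<partial>lborel)"
    by (intro nn_integral_cong)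
      (simp add: ennreal_mult'[symmetric] relu_nonneg mult_ac)
  also have "\<dots> = ennreal (unit_ball_vol n * I)"
    using vol_pos by (intro nn_integral_has_integral_lebesgue' has_integral_mult_right I)
      (simp add: relu_nonneg sqrt_nonneg)
  finally have ball: "(\<integral>\<^sup>+x. ennreal (relu (a \<bullet> x - b)) * indicator (cball 0 1) x \<partial>lborel) =
      ennreal (unit_ball_vol n * I)" .
  have vol: "emeasure lebesgue (cball 0 1 :: (real ^ 'n) set) =
      ennreal (unit_ball_vol n * Beta (1/2) (real n / 2 + 1))"
    using n by (simp add: emeasure_cball unit_ball_vol_Suc[symmetric] del: of_nat_Suc)
  have meas: "(\<lambda>x. indicator (cball 0 1) x *\<^sub>R relu (a \<bullet> x - b)) \<in> borel_measurable lebesgue"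
  proof -
    have [measurable]: "cball 0 1 \<in> sets (borel :: (real ^ 'n) measure)" by simp
    have "(\<lambda>x. indicator (cball 0 1) x *\<^sub>R relu (a \<bullet> x - b)) \<in> borel_measurable borel"
      by measurable
    then show ?thesis by (intro measurable_completion) simp
  qed
  \<comment> \<open>The integrand is nonnegative and measurable, so the Bochner integral can be read
    off from the nonnegative integral.\<close>
  have "(LINT x:cball 0 1|unit_ball_measure. relu (a \<bullet> x - b)) =
      enn2real (\<integral>\<^sup>+x. ennreal (indicator (cball 0 1) x *\<^sub>R relu (a \<bullet> x - b)) \<partial>unit_ball_measure)"
    unfolding set_lebesgue_integral_def using meas
    by (intro integral_eq_nn_integral) (auto simp: unit_ball_measure_def relu_nonneg)
  also have "(\<integral>\<^sup>+x. ennreal (indicator (cball 0 1) x *\<^sub>R relu (a \<bullet> x - b)) \<partial>unit_ball_measure) =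
      (\<integral>\<^sup>+x. ennreal (indicator (cball 0 1) x *\<^sub>R relu (a \<bullet> x - b)) * indicator (cball 0 1) x
        \<partial>lebesgue) / emeasure lebesgue (cball 0 1 :: (real ^ 'n) set)"
    unfolding unit_ball_measure_def using meas by (intro nn_integral_uniform_measure) auto
  \<comment> \<open>The ball enters twice, as domain of the set integral and as support of the
    uniform measure; the two indicators merge.\<close>
  also have "(\<integral>\<^sup>+x. ennreal (indicator (cball 0 1) x *\<^sub>R relu (a \<bullet> x - b)) * indicator (cball 0 1) x
        \<partial>lebesgue) = (\<integral>\<^sup>+x. ennreal (relu (a \<bullet> x - b)) * indicator (cball 0 1) x \<partial>lborel)"
    unfolding nn_integral_completion by (intro nn_integral_cong) (auto simp: indicator_def)
  finally show ?thesis
    using vol_pos Beta_pos I_nonneg unfolding ball vol by (simp add: divide_ennreal)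
qed

theorem lemma6p5:
  fixes a :: "real ^ 'n" and b :: real and d :: nat
  assumes d: "d = CARD('n)"
  shows "(LINT x:cball 0 1|unit_ball_measure. relu (a \<bullet> x - b)) =
    (if b \<le> - norm a then - b
     else if - norm a < b \<and> b < 0 then
       norm a / ((real d + 1) * Beta (1/2) ((real d + 1) / 2))
           * (1 - (b / norm a)\<^sup>2) powr ((real d + 1) / 2)
         - b / 2 * (1 + regularized_incomplete_beta ((b / norm a)\<^sup>2) (1/2) ((real d + 1) / 2))
     else if 0 \<le> b \<and> b < norm a then
       norm a / ((real d + 1) * Beta (1/2) ((real d + 1) / 2))
           * (1 - (b / norm a)\<^sup>2) powr ((real d + 1) / 2)
         - b / 2 * (1 - regularized_incomplete_beta ((b / norm a)\<^sup>2) (1/2) ((real d + 1) / 2))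
     else 0)"
proof -
  \<comment> \<open>The index type is nonempty, so \<open>d = n + 1\<close>, and \<open>n\<close> is
    the exponent of the density.\<close>
  obtain n where n: "CARD('n) = Suc n"
    by (metis not0_implies_Suc zero_less_card_finite less_irrefl)
  have q: "(real d + 1) / 2 = real n / 2 + 1" "real d + 1 = real n + 2"
    using d n by auto
  have Beta_pos: "0 < Beta (1/2) (real n / 2 + 1)"
    by (simp add: Beta_def Gamma_real_pos)
  \<comment> \<open>For \<open>a = 0\<close> the middle case is impossible, so \<open>norm a\<close>
    can be divided by there.\<close>
  consider "b \<le> - norm a" | "- norm a < b" "b < norm a" | "- norm a < b" "norm a \<le> b"
    by linarith
  then show ?thesis
  proof cases
    case 1
    \<comment> \<open>At \<open>c = -1\<close> the boundary term vanishes and the tail is the full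
      Beta value.\<close>
    have "((\<lambda>t. (norm a * t - b) * sqrt (1 - t\<^sup>2) ^ n) has_integral
        - b * Beta (1/2) (real n / 2 + 1)) {-1..1}"
      using has_integral_affine_sqrt_power[of "-1" "norm a" b n]
        integral_sqrt_power_tail[of "-1" n] incomplete_beta_1[of "1/2" "real n / 2 + 1"]
      by simp
    moreover have "(norm a * t - b) * sqrt (1 - t\<^sup>2) ^ n =
        relu (norm a * t - b) * sqrt (1 - t\<^sup>2) ^ n" if "t \<in> {-1..1}" for t
    proof -
      have "norm a * (-1) \<le> norm a * t" using that by (intro mult_left_mono) auto
      then show ?thesis using 1 by (simp add: relu_def)
    qed
    ultimately have "((\<lambda>t. relu (norm a * t - b) * sqrt (1 - t\<^sup>2) ^ n) has_integral
        - b * Beta (1/2) (real n / 2 + 1)) {-1..1}"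
      by (rule has_integral_eq[rotated])
    from integral_relu_unit_ball_measure[OF n this] show ?thesis
      using 1 Beta_pos by simp
  next
    case 2
    then have a: "0 < norm a" by linarith
    \<comment> \<open>The zero of \<open>norm a * t - b\<close>: the integrand vanishes to its left
      and is affine times the density to its right.\<close>
    define c where "c = b / norm a"
    have c: "-1 < c" "c < 1" using 2 a by (simp_all add: c_def field_simps)
    have sgn: "sgn c = sgn b" using a by (simp add: c_def sgn_divide)
    have c2: "0 < 1 - c\<^sup>2" using c by (simp add: abs_square_less_1 abs_less_iff)
    have powr: "(1 - c\<^sup>2) powr (real n / 2 + 1) = sqrt (1 - c\<^sup>2) ^ (n + 2)"
      using powr_half_of_nat[OF c2, of "n + 2"] by (simp add: add_divide_distrib add.commute)
    have "((\<lambda>t. relu (norm a * t - b) * sqrt (1 - t\<^sup>2) ^ n) has_integral 0) {-1..c}"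
      using a by (intro has_integral_is_0) (auto simp: relu_def c_def field_simps)
    moreover have "((\<lambda>t. relu (norm a * t - b) * sqrt (1 - t\<^sup>2) ^ n) has_integral
        norm a / (real n + 2) * sqrt (1 - c\<^sup>2) ^ (n + 2) -
        b * integral {c..1} (\<lambda>t. sqrt (1 - t\<^sup>2) ^ n)) {c..1}"
      using c a by (intro has_integral_eq[OF _ has_integral_affine_sqrt_power])
        (auto simp: relu_def c_def field_simps)
    ultimately have "((\<lambda>t. relu (norm a * t - b) * sqrt (1 - t\<^sup>2) ^ n) has_integral
        0 + (norm a / (real n + 2) * sqrt (1 - c\<^sup>2) ^ (n + 2) -
        b * integral {c..1} (\<lambda>t. sqrt (1 - t\<^sup>2) ^ n))) {-1..1}"
      using c by (intro has_integral_combine[of "-1" c 1]) auto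
    from integral_relu_unit_ball_measure[OF n this]
    \<comment> \<open>The factor \<open>sgn b\<close> merges the two middle branches of the
      statement; at \<open>b = 0\<close> the term containing it is multiplied by 0.\<close>
    have eq: "(LINT x:cball 0 1|unit_ball_measure. relu (a \<bullet> x - b)) =
        norm a / ((real n + 2) * Beta (1/2) (real n / 2 + 1)) * (1 - c\<^sup>2) powr (real n / 2 + 1)
        - b / 2 * (1 - sgn b * regularized_incomplete_beta (c\<^sup>2) (1/2) (real n / 2 + 1))"
      using integral_sqrt_power_tail[of c n] c Beta_pos
      by (simp add: powr sgn regularized_incomplete_beta_def diff_divide_distrib
          right_diff_distrib)
    show ?thesis
      unfolding q(1) unfolding q(2) c_def[symmetric] eq using 2 by (cases b "0 :: real" rule: linorder_cases) auto
  next
    case 3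
    have "relu (norm a * t - b) * sqrt (1 - t\<^sup>2) ^ n = 0" if "t \<in> {-1..1}" for t
    proof -
      have "norm a * t \<le> norm a * 1" using that by (intro mult_left_mono) auto
      then show ?thesis using 3 by (simp add: relu_def)
    qed
    then have "((\<lambda>t. relu (norm a * t - b) * sqrt (1 - t\<^sup>2) ^ n) has_integral 0) {-1..1}"
      by (rule has_integral_is_0)
    from integral_relu_unit_ball_measure[OF n this] show ?thesis
      using 3 by auto
  qed
qed

end
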